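(* Let $n\ge 1$ and let $J$ be a proper subset of $[n-1]$. Let $D_0^J(n)$ be the set of all derangements $\sigma\in\mathfrak{S}_n$ with $\mathrm{DES}\,\sigma=J$, and let $D_1^J(n)$ be the set of all permutations $\sigma\in\mathfrak{S}_n$ with $\mathrm{DES}\,\sigma=J$ and exactly one fixed point. Then there is a polynomial $Q_n^J(s)$ with nonnegative integer coefficients such that $$\sum_{\sigma\in D_0^J(n)} s^{\mathrm{exc}\,\sigma}-\sum_{\sigma\in D_1^J(n)} s^{\mathrm{exc}\,\sigma}=(s-1)\,Q_n^J(s).$$
   Context: $[n]=\{1,\dots,n\}$, and $\mathfrak{S}_n$ is the set of permutations $\sigma=\sigma_1\sigma_2\cdots\sigma_n$ of $[n]$. For $\sigma\in\mathfrak{S}_n$: $\mathrm{DES}\,\sigma=\{i:1\le i\le n-1,\ \sigma_i>\sigma_{i+1}\}$ and $\mathrm{exc}\,\sigma=|\{i\in[n]:\sigma_i>i\}|$. A derangement is a permutation with no fixed point. *)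

theory Defs
  imports "HOL-Combinatorics.Permutations" "HOL-Computational_Algebra.Polynomial"
begin

text \<open>
  A permutation \<open>\<sigma>\<close> of \<open>{1..n}\<close> is a function with \<open>\<sigma> permutes {1..n}\<close>. Such a
  function is the identity outside \<open>{1..n}\<close>, so fixed points and excedances are
  counted inside \<open>{1..n}\<close> only.
\<close>

definition DES :: "nat \<Rightarrow> (nat \<Rightarrow> nat) \<Rightarrow> nat set" where
  "DES n \<sigma> = {i \<in> {1..n - 1}. \<sigma> i > \<sigma> (i + 1)}"

definition exc :: "nat \<Rightarrow> (nat \<Rightarrow> nat) \<Rightarrow> nat" where
  "exc n \<sigma> = card {i \<in> {1..n}. \<sigma> i > i}"

definition fixed_points :: "nat \<Rightarrow> (nat \<Rightarrow> nat) \<Rightarrow> nat set" where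
  "fixed_points n \<sigma> = {i \<in> {1..n}. \<sigma> i = i}"

definition D0 :: "nat \<Rightarrow> nat set \<Rightarrow> (nat \<Rightarrow> nat) set" where
  "D0 n J = {\<sigma>. \<sigma> permutes {1..n} \<and> fixed_points n \<sigma> = {} \<and> DES n \<sigma> = J}"

definition D1 :: "nat \<Rightarrow> nat set \<Rightarrow> (nat \<Rightarrow> nat) set" where
  "D1 n J = {\<sigma>. \<sigma> permutes {1..n} \<and> card (fixed_points n \<sigma>) = 1 \<and> DES n \<sigma> = J}"

end

theory Submission
  imports Defs "HOL-Combinatorics.Multiset_Permutations"
begin

text \<open>
  Encode a permutation \<open>\<sigma>\<close> with descent set inside \<open>J\<close> by the word \<open>w\<close> whose \<open>k\<close>-th letter is the block
  of \<open>\<sigma>\<^sup>-\<^sup>1(k)\<close>. Deleting the first letter \<open>i\<close> of \<open>w\<close> lowers the number of excedances by the number of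
  fixed points of the remaining word whose letter is smaller than \<open>i\<close>. In the hook factorization of a
  word into a weakly increasing prefix and hooks, the number \<open>lec\<close> of inversions inside hooks obeys
  the same rule, with the prefix letters in place of the fixed letters. A fixed letter, respectively a
  prefix letter, can be inserted in exactly one way. These two rules determine the joint
  distribution, so (fixed letters, excedances) and (prefix letters, \<open>lec\<close>) are equidistributed on the
  words with a given content, and by inclusion-exclusion over subsets of \<open>J\<close> one gets from words to
  permutations with descent set equal to \<open>J\<close>.

  Derangements thus correspond to permutations \<open>\<pi>\<close> that are products of hooks, weighted by \<open>lec \<pi>\<close>.
  For one fixed point the prefix letter may be moved to the end without changing the content, which
  gives permutations \<open>\<pi>\<close> whose word without its last letter is a product of hooks, weighted by \<open>lec\<close>
  of the shortened word. These are the same \<open>\<pi>\<close> unless \<open>\<pi>\<close> is decreasing, and \<open>lec\<close> never drops when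
  a letter is appended.
\<close>

section \<open>Letter statistics on words\<close>

text \<open>\<open>P w\<close> collects the special letters of \<open>w\<close>: the fixed letters
  in one model, the prefix letters in the other. \<open>insert_letter\<close> asks only for a
  bijection, because the two models insert a letter at different places.\<close>

locale letter_stat =
  fixes P :: "nat list \<Rightarrow> nat multiset" and st :: "nat list \<Rightarrow> nat"
  assumes st_Nil: "st [] = 0"
    and st_Cons: "st (i # w) = st w + size (filter_mset (\<lambda>x. x < i) (P w))"
    and P_subset: "P w \<subseteq># mset w"
    and insert_letter: "\<exists>f. bij_betw f (permutations_of_multiset e)
        {w \<in> permutations_of_multiset (add_mset b e). b \<in># P w} \<and>
      (\<forall>w \<in> permutations_of_multiset e. P (f w) = add_mset b (P w) \<and> st (f w) = st w)"
begin

text \<open>The ring is left open; in the final application \<open>s\<close> is the polynomial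
  variable.\<close>

definition enum :: "'a::comm_ring_1 \<Rightarrow> nat multiset \<Rightarrow> nat multiset \<Rightarrow> 'a" where
  "enum s e F = (\<Sum>w\<in>{w \<in> permutations_of_multiset e. P w = F}. s ^ st w)"

text \<open>The bijection of \<open>insert_letter\<close> changes \<open>P\<close> in a prescribed
  way and preserves \<open>st\<close>, so it restricts to the classes with given special
  letters.\<close>

lemma enum_add_mset: "enum s (add_mset b e) (add_mset b F) = enum s e F"
proof -
  obtain f where bij: "bij_betw f (permutations_of_multiset e)
        {w \<in> permutations_of_multiset (add_mset b e). b \<in># P w}"
    and f: "\<And>w. w \<in> permutations_of_multiset e \<Longrightarrow> P (f w) = add_mset b (P w) \<and> st (f w) = st w"
    using insert_letter[of e b] by blast
  have "bij_betw f {w \<in> permutations_of_multiset e. P w = F}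
     {w \<in> permutations_of_multiset (add_mset b e). P w = add_mset b F}"
    unfolding bij_betw_def
  proof
    show "inj_on f {w \<in> permutations_of_multiset e. P w = F}"
      using bij by (auto simp: bij_betw_def inj_on_def)
    show "f ` {w \<in> permutations_of_multiset e. P w = F} =
        {w \<in> permutations_of_multiset (add_mset b e). P w = add_mset b F}" (is "?L = ?R")
    proof
      show "?L \<subseteq> ?R" using bij f by (fastforce simp: bij_betw_def)
      show "?R \<subseteq> ?L"
      proof
        fix w assume w: "w \<in> ?R"
        then have "w \<in> f ` permutations_of_multiset e"
          using bij by (auto simp: bij_betw_def)
        then obtain u where "u \<in> permutations_of_multiset e" "w = f u" by blast
        then show "w \<in> ?L" using w f by auto
      qed
    qed
  qed
  then have "enum s (add_mset b e) (add_mset b F) =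
      (\<Sum>w\<in>{w \<in> permutations_of_multiset e. P w = F}. s ^ st (f w))"
    unfolding enum_def by (rule sum.reindex_bij_betw[symmetric])
  also have "\<dots> = enum s e F"
    unfolding enum_def using f by (intro sum.cong) auto
  finally show ?thesis .
qed

lemma enum_not_subset: "\<not> F \<subseteq># e \<Longrightarrow> enum s e F = 0"
  unfolding enum_def using P_subset by (intro sum.neutral) (auto simp: permutations_of_multiset_def)

text \<open>\<open>T\<close> may be any finite superset of the values of \<open>P\<close>, so that
  two statistics can be compared over one index set.\<close>

lemma sum_by_letters:
  assumes "finite T" "P ` permutations_of_multiset e \<subseteq> T"
  shows "(\<Sum>w\<in>permutations_of_multiset e. h (P w) * s ^ st w) = (\<Sum>F\<in>T. h F * enum s e F)"
proof -
  have "(\<Sum>w\<in>permutations_of_multiset e. h (P w) * s ^ st w) =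
     (\<Sum>F\<in>T. \<Sum>w\<in>{w \<in> permutations_of_multiset e. P w = F}. h (P w) * s ^ st w)"
    using assms by (intro sum.group[symmetric]) auto
  also have "\<dots> = (\<Sum>F\<in>T. h F * enum s e F)"
    unfolding enum_def sum_distrib_left by (intro sum.cong) auto
  finally show ?thesis .
qed

text \<open>Words are split by their first letter. The new factor depends on \<open>P w\<close>
  only, which is the form that \<open>sum_by_letters\<close> handles.\<close>

lemma sum_Cons:
  fixes s :: "'a::comm_ring_1"
  assumes "e \<noteq> {#}"
  shows "(\<Sum>w\<in>permutations_of_multiset e. s ^ st w) =
    (\<Sum>i\<in>set_mset e. \<Sum>w\<in>permutations_of_multiset (e - {#i#}).
       s ^ size (filter_mset (\<lambda>x. x < i) (P w)) * s ^ st w)"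
proof -
  have "(\<Sum>w\<in>permutations_of_multiset e. s ^ st w) =
    (\<Sum>i\<in>set_mset e. \<Sum>w\<in>(#) i ` permutations_of_multiset (e - {#i#}). s ^ st w)"
    unfolding permutations_of_multiset_nonempty[OF assms]
    by (rule sum.UNION_disjoint) auto
  also have "\<dots> = (\<Sum>i\<in>set_mset e. \<Sum>w\<in>permutations_of_multiset (e - {#i#}).
       s ^ size (filter_mset (\<lambda>x. x < i) (P w)) * s ^ st w)"
    by (intro sum.cong[OF refl]) (simp add: sum.reindex st_Cons power_add mult.commute)
  finally show ?thesis .
qed

lemma enum_singleton:
  assumes "b \<in># e"
  shows "enum s e {#b#} = enum s (e - {#b#}) {#}"
  using enum_add_mset[of s b "e - {#b#}" "{#}"] assms by simp

text \<open>Deleting the only special letter \<open>b\<close> leaves a word of content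
  \<open>e - {#b#}\<close> without special letters. This serves the case of one fixed point.\<close>

lemma sum_one_letter:
  "(\<Sum>w\<in>{w \<in> permutations_of_multiset e. size (P w) = 1}. s ^ st w) =
   (\<Sum>b\<in>set_mset e. enum s (e - {#b#}) {#})"
proof -
  have "{w \<in> permutations_of_multiset e. size (P w) = 1} =
     (\<Union>b\<in>set_mset e. {w \<in> permutations_of_multiset e. P w = {#b#}})" (is "?L = ?R")
  proof
    show "?L \<subseteq> ?R"
    proof
      fix w assume w: "w \<in> ?L"
      then obtain b where b: "P w = {#b#}" using size_1_singleton_mset[of "P w"] by auto
      then have "b \<in># e" using P_subset[of w] w by (auto simp: permutations_of_multiset_def)
      then show "w \<in> ?R" using b w by auto
    qed
  qed auto
  then have "(\<Sum>w\<in>{w \<in> permutations_of_multiset e. size (P w) = 1}. s ^ st w) =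
     (\<Sum>b\<in>set_mset e. enum s e {#b#})"
    unfolding enum_def by (simp only:, intro sum.UNION_disjoint) auto
  then show ?thesis by (simp add: enum_singleton)
qed

end

text \<open>
  Summing over all words, \<open>st_Cons\<close> expresses the total of a content by smaller contents, and
  \<open>insert_letter\<close> does the same for every summand except the one with no special letter.
  So these axioms determine the enumerators.
\<close>

lemma enum_unique:
  fixes s :: "'a::comm_ring_1"
  assumes "letter_stat P st" "letter_stat P' st'"
  shows "letter_stat.enum P st s e F = letter_stat.enum P' st' s e F"
proof (induction "size e" arbitrary: e F rule: less_induct)
  case less
  interpret A: letter_stat P st by fact
  interpret B: letter_stat P' st' by fact
  define T where "T = (\<lambda>e. P ` permutations_of_multiset e \<union> P' ` permutations_of_multiset e)"
  have finT: "finite (T e)" for e by (simp add: T_def)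
  have eqsum: "(\<Sum>w\<in>permutations_of_multiset d. h (P w) * s ^ st w) =
      (\<Sum>w\<in>permutations_of_multiset d. h (P' w) * s ^ st' w)" if "size d < size e" for d h
    using A.sum_by_letters[of "T d" d h s] B.sum_by_letters[of "T d" d h s] finT less[OF that]
    by (simp add: T_def)
  have pos: "A.enum s e G = B.enum s e G" if ne: "G \<noteq> {#}" for G
  proof (cases "G \<subseteq># e")
    case True
    obtain b G' where G: "G = add_mset b G'" using ne by (blast dest: multi_nonempty_split)
    with True have "b \<in># e" by (auto dest: mset_subset_eqD)
    then obtain e' where e: "e = add_mset b e'" by (blast dest: multi_member_split)
    show ?thesis unfolding G unfolding e A.enum_add_mset B.enum_add_mset by (rule less) (simp add: e)
  qed (simp add: A.enum_not_subset B.enum_not_subset)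
  have tot: "(\<Sum>w\<in>permutations_of_multiset e. s ^ st w) = (\<Sum>w\<in>permutations_of_multiset e. s ^ st' w)"
  proof (cases "e = {#}")
    case True
    then show ?thesis by (simp add: A.st_Nil B.st_Nil)
  next
    case False
    show ?thesis unfolding A.sum_Cons[OF False] B.sum_Cons[OF False]
      by (intro sum.cong refl eqsum) (simp add: size_Diff1_less)
  qed
  \<comment> \<open>Both sides are totals over all words. Once the nonempty summands, equal by
    \<open>pos\<close>, are cancelled, only the one for \<open>{#}\<close> remains.\<close>
  have "(\<Sum>F\<in>insert {#} (T e). A.enum s e F) = (\<Sum>F\<in>insert {#} (T e). B.enum s e F)"
    using A.sum_by_letters[of "insert {#} (T e)" e "\<lambda>_. 1" s]
      B.sum_by_letters[of "insert {#} (T e)" e "\<lambda>_. 1" s] finT tot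
    by (simp add: T_def subset_insertI2)
  moreover have "(\<Sum>F\<in>T e - {{#}}. A.enum s e F) = (\<Sum>F\<in>T e - {{#}}. B.enum s e F)"
    by (intro sum.cong) (auto simp: pos)
  ultimately have "A.enum s e {#} = B.enum s e {#}"
    using finT by (simp add: sum.insert_remove)
  then show ?case using pos by (cases "F = {#}") auto
qed

section \<open>Hook factorization\<close>

text \<open>
  Every word factors uniquely into a weakly increasing word \<open>pix w\<close> followed by hooks
  \<open>x\<^sub>1 > x\<^sub>2 \<le> \<dots> \<le> x\<^sub>k\<close>; \<open>lec w\<close> is the number of inversions inside the hooks.
\<close>

fun pix :: "nat list \<Rightarrow> nat list" where
  "pix [] = []"
| "pix (i # w) = (case pix w of [] \<Rightarrow> [i] | x # xs \<Rightarrow> if i \<le> x then i # x # xs else [])"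

fun lec :: "nat list \<Rightarrow> nat" where
  "lec [] = 0"
| "lec (i # w) = lec w + length (filter (\<lambda>x. x < i) (pix w))"

lemma sorted_pix: "sorted (pix w)"
  by (induction w) (auto split: list.splits intro: order_trans)

lemma pix_append_rest: "pix w @ drop (length (pix w)) w = w"
  by (induction w) (auto split: list.splits)

lemma pix_rest: "pix (drop (length (pix w)) w) = []"
  by (induction w) (auto split: list.splits)

text \<open>Uniqueness of the factorization; existence is given by \<open>sorted_pix\<close>,
  \<open>pix_append_rest\<close> and \<open>pix_rest\<close>.\<close>

lemma pix_append: "sorted p \<Longrightarrow> pix r = [] \<Longrightarrow> pix (p @ r) = p"
  by (induction p) (auto split: list.splits)

lemma lec_append: "sorted p \<Longrightarrow> pix r = [] \<Longrightarrow> lec (p @ r) = lec r"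
  by (induction p) (auto simp: pix_append filter_empty_conv)

lemma lec_rest: "lec (drop (length (pix w)) w) = lec w"
  using lec_append[OF sorted_pix pix_rest, of w w] by (simp add: pix_append_rest)

lemma set_pix: "set (pix w) \<subseteq> set w"
  by (metis pix_append_rest set_append sup_ge1)

text \<open>A letter is inserted at its sorted place in the prefix, and the hooks stay untouched.
  Hence \<open>pix\<close> determines how to undo the insertion.\<close>

interpretation pix: letter_stat "\<lambda>w. mset (pix w)" lec
proof
  fix i w e b
  show "lec [] = 0" by simp
  show "lec (i # w) = lec w + size (filter_mset (\<lambda>x. x < i) (mset (pix w)))"
    by (simp flip: mset_filter)
  show "mset (pix w) \<subseteq># mset w"
    by (metis mset_append mset_subset_eq_add_left pix_append_rest)
  define f where "f = (\<lambda>w. insort b (pix w) @ drop (length (pix w)) w)"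
  have pf: "pix (f w) = insort b (pix w)" and lf: "lec (f w) = lec w" for w
    unfolding f_def by (auto simp: pix_append lec_append sorted_insort sorted_pix pix_rest lec_rest)
  have mf: "mset (f w) = add_mset b (mset w)" for w
    using arg_cong[OF pix_append_rest[of w], of mset] by (simp add: f_def)
  have "inj f"
  proof (rule injI)
    fix u v assume eq: "f u = f v"
    then have ins: "insort b (pix u) = insort b (pix v)" using pf by metis
    then have "pix u = pix v" by (metis remove1_insort_key)
    with eq have "drop (length (pix u)) u = drop (length (pix v)) v" by (simp add: f_def)
    with \<open>pix u = pix v\<close> show "u = v" using pix_append_rest by metis
  qed
  moreover have "w \<in> f ` permutations_of_multiset e"
    if w: "mset w = add_mset b e" "b \<in> set (pix w)" for w
  proof
    let ?u = "remove1 b (pix w) @ drop (length (pix w)) w"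
    have pu: "pix ?u = remove1 b (pix w)"
      by (simp add: pix_append sorted_remove1 sorted_pix pix_rest)
    show fu: "w = f ?u"
      unfolding f_def pu using w by (simp add: insort_remove1 sorted_pix pix_append_rest)
    have "add_mset b (mset ?u) = add_mset b e" using mf[of ?u] fu w by simp
    then show "?u \<in> permutations_of_multiset e" by (simp add: permutations_of_multiset_def)
  qed
  ultimately have "bij_betw f (permutations_of_multiset e)
       {w \<in> permutations_of_multiset (add_mset b e). b \<in># mset (pix w)}"
    unfolding bij_betw_def
    by (auto simp: permutations_of_multiset_def mf pf set_insort_key intro: inj_on_subset)
  then show "\<exists>f. bij_betw f (permutations_of_multiset e)
        {w \<in> permutations_of_multiset (add_mset b e). b \<in># mset (pix w)} \<and>
      (\<forall>w \<in> permutations_of_multiset e. mset (pix (f w)) = add_mset b (mset (pix w)) \<and> lec (f w) = lec w)"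
    using pf lf by (intro exI[of _ f]) auto
qed

text \<open>\<open>pix\<close> and \<open>lec\<close> only ask whether a later letter is smaller
  than an earlier one. So \<open>g\<close> may even merge letters that stand in increasing order, as
  \<open>block J\<close> will do.\<close>

lemma pix_lec_map:
  assumes "sorted_wrt (\<lambda>x y. y < x \<longleftrightarrow> g y < g x) w"
  shows "pix (map g w) = map g (pix w) \<and> lec (map g w) = lec w"
  using assms
proof (induction w)
  case (Cons i w)
  have "\<And>x. x \<in> set (pix w) \<Longrightarrow> x < i \<longleftrightarrow> g x < g i" using Cons.prems set_pix[of w] by auto
  then have "filter (\<lambda>x. g x < g i) (pix w) = filter (\<lambda>x. x < i) (pix w)"
      "\<And>x xs. pix w = x # xs \<Longrightarrow> g i \<le> g x \<longleftrightarrow> i \<le> x"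
    by (auto intro!: filter_cong simp flip: not_less)
  then show ?case using Cons by (auto simp: filter_map o_def split: list.splits)
qed simp

section \<open>Deleting the last letter\<close>

text \<open>
  The three alternatives: appending \<open>x\<close> leaves the prefix alone, lengthens it by one letter, or
  costs it one letter, which must then be paid for by an inversion.
\<close>

lemma lec_snoc_aux:
  defines "dec w z \<equiv> sorted_wrt (\<lambda>x y. y < x) w \<and> z = hd w"
  shows "pix (u @ [x]) = pix u \<and> lec u \<le> lec (u @ [x]) \<or>
    (\<exists>z. pix (u @ [x]) = pix u @ [z] \<and> lec u \<le> lec (u @ [x]) \<and> (pix u = [] \<longrightarrow> dec (u @ [x]) z)) \<or>
    (\<exists>z. pix u = pix (u @ [x]) @ [z] \<and> lec u + 1 \<le> lec (u @ [x]) \<and>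
       (pix (u @ [x]) = [] \<longrightarrow> dec (u @ [x]) z))"
    (is "?A u \<or> ?B u \<or> ?C u")
proof (induction u)
  case (Cons i u)
  \<comment> \<open>If the shorter prefix is empty and \<open>z < i\<close>, prepending
    \<open>i\<close> exchanges the second and third alternatives, and the whole word stays
    decreasing.\<close>
  have dec_Cons: "dec ((i # u) @ [x]) i" if "dec (u @ [x]) z" "z < i" for z
  proof -
    have "\<forall>y\<in>set (u @ [x]). y \<le> z"
      using that(1) unfolding dec_def by (cases "u @ [x]") auto
    with that show ?thesis unfolding dec_def by fastforce
  qed
  from Cons show ?case
  proof (elim disjE)
    assume "?A u"
    then show ?thesis by auto
  next
    assume "?B u"
    then obtain z where z: "pix (u @ [x]) = pix u @ [z]" "lec u \<le> lec (u @ [x])"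
      "pix u = [] \<longrightarrow> dec (u @ [x]) z" by blast
    show ?thesis
    proof (cases "pix u")
      case Nil
      then show ?thesis using z dec_Cons by (cases "i \<le> z") auto
    next
      case (Cons y ys)
      then show ?thesis using z by (cases "i \<le> y") auto
    qed
  next
    assume "?C u"
    then obtain z where z: "pix u = pix (u @ [x]) @ [z]" "lec u + 1 \<le> lec (u @ [x])"
      "pix (u @ [x]) = [] \<longrightarrow> dec (u @ [x]) z" by blast
    show ?thesis
    proof (cases "pix (u @ [x])")
      case Nil
      then show ?thesis using z dec_Cons by (cases "i \<le> z") auto
    next
      case (Cons y ys)
      \<comment> \<open>If \<open>i \<le> y\<close>, the lost letter \<open>z\<close> is therefore
        not counted by \<open>lec\<close> either.\<close>
      moreover have "y \<le> z" using sorted_pix[of u] z(1) Cons by auto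
      ultimately show ?thesis using z by (cases "i \<le> y") auto
    qed
  qed
qed (auto simp: dec_def)

text \<open>By \<open>lec_snoc_aux\<close> the prefix can become empty or nonempty only when the
  word is decreasing. Along decreasing words it alternates between empty and a single
  letter.\<close>

lemma lec_butlast:
  assumes "\<not> sorted_wrt (\<lambda>x y. y < x) w"
  shows "pix (butlast w) = [] \<longleftrightarrow> pix w = []" and "lec (butlast w) \<le> lec w"
proof -
  have "w \<noteq> []" using assms by auto
  then obtain u x where w: "w = u @ [x]" by (metis rev_exhaust)
  show "pix (butlast w) = [] \<longleftrightarrow> pix w = []" and "lec (butlast w) \<le> lec w"
    using lec_snoc_aux[of u x] assms unfolding w by auto
qed

text \<open>The last letter \<open>b\<close> is arbitrary and the rest is a product of hooks, so the
  right-hand side is the one of \<open>sum_one_letter\<close>.\<close>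

lemma sum_butlast:
  assumes "e \<noteq> {#}"
  shows "(\<Sum>w\<in>{w \<in> permutations_of_multiset e. pix (butlast w) = []}. s ^ lec (butlast w)) =
    (\<Sum>b\<in>set_mset e. pix.enum s (e - {#b#}) {#})"
proof -
  let ?U = "\<lambda>b. {w \<in> permutations_of_multiset (e - {#b#}). mset (pix w) = {#}}"
  have "{w \<in> permutations_of_multiset e. pix (butlast w) = []} =
      (\<Union>b\<in>set_mset e. (\<lambda>u. u @ [b]) ` ?U b)" (is "?L = ?R")
  proof
    show "?L \<subseteq> ?R"
    proof
      fix w assume w: "w \<in> ?L"
      with assms have "w \<noteq> []" by (auto simp: permutations_of_multiset_def)
      then obtain u b where "w = u @ [b]" by (metis rev_exhaust)
      with w show "w \<in> ?R" by (auto simp: permutations_of_multiset_def)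
    qed
  qed (auto simp: permutations_of_multiset_def)
  then have "(\<Sum>w\<in>{w \<in> permutations_of_multiset e. pix (butlast w) = []}. s ^ lec (butlast w)) =
      (\<Sum>b\<in>set_mset e. \<Sum>w\<in>(\<lambda>u. u @ [b]) ` ?U b. s ^ lec (butlast w))"
    by (simp only:, intro sum.UNION_disjoint) auto
  also have "\<dots> = (\<Sum>b\<in>set_mset e. pix.enum s (e - {#b#}) {#})"
    unfolding pix.enum_def
    by (intro sum.cong[OF refl]) (simp add: sum.reindex inj_on_def)
  finally show ?thesis .
qed

section \<open>Fixed points and excedances of words\<close>

text \<open>
  \<open>rank w\<close> is the standardization of \<open>w\<close> with positions and values counted from 0. The
  excedances of the inverse of this permutation are the positions \<open>k\<close> with \<open>rank w k < k\<close>.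
\<close>

definition rank :: "nat list \<Rightarrow> nat \<Rightarrow> nat" where
  "rank w k = length (filter (\<lambda>x. x < w ! k) w) + length (filter (\<lambda>x. x = w ! k) (take k w))"

definition fix_letters :: "nat list \<Rightarrow> nat multiset" where
  "fix_letters w = mset (map ((!) w) (filter (\<lambda>k. rank w k = k) [0..<length w]))"

definition word_exc :: "nat list \<Rightarrow> nat" where
  "word_exc w = length (filter (\<lambda>k. rank w k < k) [0..<length w])"


section \<open>Inserting and deleting fixed letters\<close>

lemma rank_append_left:
  "l < length x \<Longrightarrow> rank (x @ b # y) l = rank (x @ y) l + (if b < (x @ y) ! l then 1 else 0)"
  by (simp add: rank_def nth_append)

text \<open>Ties are ranked from left to right, so an inserted \<open>b\<close> also pushes up the
  equal letters after it, but not those before it.\<close>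

lemma rank_append_right:
  "length x \<le> l \<Longrightarrow> rank (x @ b # y) (Suc l) = rank (x @ y) l + (if b \<le> (x @ y) ! l then 1 else 0)"
  by (auto simp: rank_def nth_append Suc_diff_le)

text \<open>The left-hand side is the rank that \<open>b\<close> receives between \<open>x\<close>
  and \<open>y\<close>; the equation makes it a fixed letter there.\<close>

definition balanced :: "nat \<Rightarrow> nat list \<Rightarrow> nat list \<Rightarrow> bool" where
  "balanced b x y \<longleftrightarrow>
    length (filter (\<lambda>z. z < b) (x @ y)) + length (filter (\<lambda>z. z = b) x) = length x"

lemma rank_append_middle: "rank (x @ b # y) (length x) = length x \<longleftrightarrow> balanced b x y"
  by (simp add: rank_def balanced_def nth_append)

lemma length_filter_less_eq:
  fixes a b :: nat
  shows "a < b \<Longrightarrow> length (filter (\<lambda>z. z < a) w) + length (filter (\<lambda>z. z = a) w)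
    \<le> length (filter (\<lambda>z. z < b) w)"
  by (induction w) auto

lemma rank_lower:
  assumes "b < (x @ y) ! l"
  shows "length (filter (\<lambda>z. z < b) (x @ y)) + length (filter (\<lambda>z. z = b) x) \<le> rank (x @ y) l"
  using length_filter_less_eq[OF assms, of "x @ y"] by (simp add: rank_def)

lemma rank_upper:
  assumes "w ! l < b" "l < length w"
  shows "rank w l < length (filter (\<lambda>z. z < b) w)"
proof -
  define p a q where "p = take l w" and "a = w ! l" and "q = drop (Suc l) w"
  have w: "w = p @ a # q" unfolding p_def a_def q_def using assms(2) by (rule id_take_nth_drop)
  have "rank w l = length (filter (\<lambda>z. z < a) w) + length (filter (\<lambda>z. z = a) p)"
    by (simp add: rank_def p_def a_def)
  moreover have "a < b" using assms(1) by (simp add: a_def)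
  ultimately show ?thesis
    using length_filter_less_eq[of a b p] length_filter_less_eq[of a b q] by (simp add: w)
qed

text \<open>Only ranks of letters above \<open>b\<close> grow, and by \<open>rank_lower\<close>
  these are at least \<open>length x > l\<close> already.\<close>

lemma rank_insert_left:
  assumes "balanced b x y" "l < length x"
  shows "rank (x @ b # y) l < l \<longleftrightarrow> rank (x @ y) l < l"
    and "rank (x @ b # y) l = l \<longleftrightarrow> rank (x @ y) l = l"
  using assms rank_lower[of b x y l] by (auto simp: rank_append_left balanced_def)

text \<open>Position and rank both grow by one, except for letters below \<open>b\<close>. Those
  have rank less than \<open>length x \<le> l\<close> by \<open>rank_upper\<close>, so they remain
  excedances.\<close>

lemma rank_insert_right:
  assumes "balanced b x y" "length x \<le> l" "l < length (x @ y)"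
  shows "rank (x @ b # y) (Suc l) < Suc l \<longleftrightarrow> rank (x @ y) l < l"
    and "rank (x @ b # y) (Suc l) = Suc l \<longleftrightarrow> rank (x @ y) l = l"
  using assms rank_upper[of "x @ y" l b] by (auto simp: rank_append_right balanced_def not_le)

lemma filter_upt_insert:
  "filter Q [0..<Suc (k + m)] =
   filter Q [0..<k] @ (if Q k then [k] else []) @ map Suc (filter (\<lambda>l. Q (Suc l)) [k..<k + m])"
proof -
  have "[0..<Suc (k + m)] = [0..<k] @ k # map Suc [k..<k + m]"
    using upt_add_eq_append[of 0 k "Suc m"] by (simp add: upt_conv_Cons map_Suc_upt del: upt_Suc)
  then show ?thesis by (simp add: filter_map o_def del: upt_Suc)
qed

lemma filter_upt_split:
  "filter Q [0..<k + m] = filter Q [0..<k] @ filter Q [k..<k + m]"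
  using upt_add_eq_append[of 0 k m] by simp

lemma fix_letters_insert:
  assumes "balanced b x y"
  shows "fix_letters (x @ b # y) = add_mset b (fix_letters (x @ y))"
proof -
  let ?w = "x @ y" and ?v = "x @ b # y" and ?k = "length x" and ?m = "length y"
  have 1: "map ((!) ?v) (filter (\<lambda>l. rank ?v l = l) [0..<?k]) =
      map ((!) ?w) (filter (\<lambda>l. rank ?w l = l) [0..<?k])"
    using rank_insert_left[OF assms] by (intro map_cong filter_cong) (auto simp: nth_append)
  have 2: "map ((!) ?v) (map Suc (filter (\<lambda>l. rank ?v (Suc l) = Suc l) [?k..<?k + ?m])) =
      map ((!) ?w) (filter (\<lambda>l. rank ?w l = l) [?k..<?k + ?m])"
    unfolding map_map using rank_insert_right[OF assms]
    by (intro map_cong filter_cong) (auto simp: nth_append Suc_diff_le)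
  have 3: "rank ?v ?k = ?k" using assms by (simp add: rank_append_middle)
  have "length ?v = Suc (?k + ?m)" "length ?w = ?k + ?m" by simp_all
  then show ?thesis
    unfolding fix_letters_def filter_upt_insert filter_upt_split map_append 1 2
    by (simp only: filter_upt_insert filter_upt_split map_append 1 2 3) simp
qed

lemma word_exc_insert:
  assumes "balanced b x y"
  shows "word_exc (x @ b # y) = word_exc (x @ y)"
proof -
  have "filter (\<lambda>l. rank (x @ b # y) l < l) [0..<length x] = filter (\<lambda>l. rank (x @ y) l < l) [0..<length x]"
    "filter (\<lambda>l. rank (x @ b # y) (Suc l) < Suc l) [length x..<length x + length y] =
     filter (\<lambda>l. rank (x @ y) l < l) [length x..<length x + length y]"
    using rank_insert_left[OF assms] rank_insert_right[OF assms] by (auto intro!: filter_cong)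
  then show ?thesis
    using rank_append_middle[of x b y] assms
    by (simp add: word_exc_def filter_upt_insert filter_upt_split del: upt_Suc)
qed

lemma all_equal_shift:
  assumes "length (filter (\<lambda>z. z = b) m) = length m"
  shows "m @ [b] = b # m"
proof -
  have "\<forall>z\<in>set m. z = b" using assms length_filter_less[of _ m "\<lambda>z. z = b"] by force
  then show ?thesis by (induction m) auto
qed

text \<open>Subtracting the two balance equations shows that every letter between the two cuts
  equals \<open>b\<close>.\<close>

lemma insert_unique:
  assumes "x @ y = x' @ y'" "balanced b x y" "balanced b x' y'"
  shows "x @ b # y = x' @ b # y'"
proof -
  have key: "x @ b # m @ y' = (x @ m) @ b # y'" if "balanced b x (m @ y')" "balanced b (x @ m) y'" for x m y'
  proof -
    have "length (filter (\<lambda>z. z = b) m) = length m" using that by (auto simp: balanced_def)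
    then have "m @ [b] = b # m" by (rule all_equal_shift)
    then show ?thesis by simp
  qed
  from assms(1) consider m where "x' = x @ m" "y = m @ y'" | m where "x = x' @ m" "y' = m @ y"
    by (auto simp: append_eq_append_conv2)
  then show ?thesis
  proof cases
    case (1 m)
    then show ?thesis using key[of x m y'] assms(2,3) by metis
  next
    case (2 m)
    then show ?thesis using key[of x' m y] assms(2,3) by metis
  qed
qed

text \<open>For the same reason, two fixed occurrences of \<open>b\<close> have only copies of
  \<open>b\<close> between them.\<close>

lemma remove_unique:
  assumes "x @ b # y = x' @ b # y'" "balanced b x y" "balanced b x' y'"
  shows "x @ y = x' @ y'"
proof -
  have key: "x @ m @ b # y' = x @ b # m @ y'"
    if "balanced b x (m @ b # y')" "balanced b (x @ b # m) y'" for x m y'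
  proof -
    have "length (filter (\<lambda>z. z = b) m) = length m" using that by (auto simp: balanced_def)
    then have "m @ [b] = b # m" by (rule all_equal_shift)
    then show ?thesis by simp
  qed
  from assms(1) consider "x = x'" "y = y'"
    | m where "x' = x @ b # m" "y = m @ b # y'" | m where "x = x' @ b # m" "y' = m @ b # y"
    by (auto simp: append_eq_append_conv2 Cons_eq_append_conv append_eq_Cons_conv)
  then show ?thesis
  proof cases
    case (2 m)
    then show ?thesis using key[of x m y'] assms(2,3) by simp
  next
    case (3 m)
    then show ?thesis using key[of x' m y] assms(2,3) by simp
  qed simp
qed

text \<open>A discrete intermediate value argument: \<open>?c\<close> is nondecreasing,
  \<open>?c 0 \<ge> 0\<close> and \<open>?c (length w) \<le> length w\<close>, so at the least
  \<open>k\<close> with \<open>?c k \<le> k\<close> equality holds.\<close>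

lemma balanced_exists: "\<exists>x y. w = x @ y \<and> balanced b x y"
proof -
  let ?c = "\<lambda>k. length (filter (\<lambda>z. z < b) w) + length (filter (\<lambda>z. z = b) (take k w))"
  define k where "k = (LEAST k. ?c k \<le> k)"
  have "?c (length w) \<le> length w" by (induction w) auto
  then have k: "?c k \<le> k" "k \<le> length w"
    unfolding k_def by (rule LeastI, rule Least_le)
  have "k \<le> ?c k"
  proof (cases k)
    case (Suc j)
    then have "\<not> ?c j \<le> j" unfolding k_def by (intro not_less_Least) simp
    moreover have "?c j \<le> ?c (Suc j)"
      by (cases "j < length w") (simp_all add: take_Suc_conv_app_nth)
    ultimately show ?thesis using Suc by simp
  qed simp
  with k have "balanced b (take k w) (drop k w)" by (simp add: balanced_def)
  then show ?thesis by (intro exI[of _ "take k w"] exI[of _ "drop k w"]) simp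
qed

lemma length_filter_disj:
  assumes "\<And>x. x \<in> set xs \<Longrightarrow> A x \<longleftrightarrow> B x \<or> C x" "\<And>x. x \<in> set xs \<Longrightarrow> \<not> (B x \<and> C x)"
  shows "length (filter A xs) = length (filter B xs) + length (filter C xs)"
  using assms by (induction xs) auto

interpretation fix_letters: letter_stat fix_letters word_exc
proof
  fix i w e b
  show "word_exc [] = 0" by (simp add: word_exc_def)
  have "word_exc (i # w) = length (filter (\<lambda>k. rank (i # w) (Suc k) < Suc k) [0..<length w])"
    using filter_upt_insert[of "\<lambda>k. rank (i # w) k < k" 0 "length w"]
    by (simp add: word_exc_def del: upt_Suc)
  \<comment> \<open>Prepending \<open>i\<close> raises the position of every letter but the rank
    only of letters \<open>\<ge> i\<close>. So the new excedances are the fixed letters below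
    \<open>i\<close>.\<close>
  also have "\<dots> = length (filter (\<lambda>k. rank w k < k) [0..<length w]) +
      length (filter (\<lambda>k. rank w k = k \<and> w ! k < i) [0..<length w])"
    using rank_append_right[of "[]" _ i w] by (intro length_filter_disj) auto
  also have "\<dots> = word_exc w + size (filter_mset (\<lambda>x. x < i) (fix_letters w))"
    unfolding fix_letters_def mset_filter[symmetric] size_mset filter_map length_map filter_filter
    by (simp add: word_exc_def conj_commute)
  finally show "word_exc (i # w) = word_exc w + size (filter_mset (\<lambda>x. x < i) (fix_letters w))" .
  have "fix_letters w \<subseteq># mset (map ((!) w) [0..<length w])"
    unfolding fix_letters_def mset_map mset_filter
    by (intro image_mset_subseteq_mono multiset_filter_subset)
  then show "fix_letters w \<subseteq># mset w" by (simp only: map_nth)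
  \<comment> \<open>One balanced cut is chosen per word; by \<open>insert_unique\<close> the choice
    does not affect the resulting word.\<close>
  obtain X Y where XY: "\<And>w. w = X w @ Y w" "\<And>w. balanced b (X w) (Y w)"
    using balanced_exists[of _ b] by metis
  define f where "f = (\<lambda>w. X w @ b # Y w)"
  have ff: "fix_letters (f w) = add_mset b (fix_letters w)" and ef: "word_exc (f w) = word_exc w" for w
    unfolding f_def using fix_letters_insert[OF XY(2)] word_exc_insert[OF XY(2)] XY(1) by metis+
  have mf: "mset (f w) = add_mset b (mset w)" for w
    using arg_cong[OF XY(1)[of w], of mset] by (simp add: f_def)
  have "inj f"
  proof (rule injI)
    fix u v assume "f u = f v"
    then have "X u @ Y u = X v @ Y v" unfolding f_def using XY(2) by (rule remove_unique) (rule XY)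
    then show "u = v" using XY(1) by metis
  qed
  moreover have "w \<in> f ` permutations_of_multiset e"
    if w: "mset w = add_mset b e" "b \<in># fix_letters w" for w
  proof -
    from w(2) obtain k where k: "k < length w" "rank w k = k" "w ! k = b"
      by (auto simp: fix_letters_def)
    define x y where "x = take k w" and "y = drop (Suc k) w"
    have xy: "w = x @ b # y" "length x = k"
      using id_take_nth_drop[OF k(1)] k by (simp_all add: x_def y_def)
    then have "balanced b x y" using rank_append_middle[of x b y] k by simp
    then have "w = f (x @ y)"
      unfolding f_def xy(1) using XY by (intro insert_unique) auto
    moreover from this have "x @ y \<in> permutations_of_multiset e"
      using mf[of "x @ y"] w by (simp add: permutations_of_multiset_def)
    ultimately show ?thesis by (rule image_eqI)
  qed
  ultimately have "bij_betw f (permutations_of_multiset e)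
       {w \<in> permutations_of_multiset (add_mset b e). b \<in># fix_letters w}"
    unfolding bij_betw_def
    by (auto simp: permutations_of_multiset_def mf ff intro: inj_on_subset)
  then show "\<exists>f. bij_betw f (permutations_of_multiset e)
        {w \<in> permutations_of_multiset (add_mset b e). b \<in># fix_letters w} \<and>
      (\<forall>w \<in> permutations_of_multiset e. fix_letters (f w) = add_mset b (fix_letters w) \<and>
         word_exc (f w) = word_exc w)"
    using ff ef by (intro exI[of _ f]) auto
qed

section \<open>Permutations and words\<close>

text \<open>
  A permutation with descent set inside \<open>J\<close> increases on the blocks cut out by \<open>J\<close>, hence is
  determined by the word listing the block of the preimage of each value.
\<close>

definition block :: "nat set \<Rightarrow> nat \<Rightarrow> nat" where
  "block J q = card {j \<in> J. j < q}"

definition inv_word :: "nat \<Rightarrow> (nat \<Rightarrow> nat) \<Rightarrow> nat list" where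
  "inv_word n \<sigma> = map (inv \<sigma>) [1..<Suc n]"

lemma block_mono: "finite J \<Longrightarrow> p \<le> q \<Longrightarrow> block J p \<le> block J q"
  unfolding block_def by (intro card_mono) auto

lemma block_Suc: "finite J \<Longrightarrow> q \<in> J \<Longrightarrow> block J q < block J (Suc q)"
  unfolding block_def by (intro psubset_card_mono) auto

lemma block_Suc_eq: "q \<notin> J \<Longrightarrow> block J (Suc q) = block J q"
  unfolding block_def by (intro arg_cong[where f = card]) (auto simp: less_Suc_eq)

lemma length_inv_word [simp]: "length (inv_word n \<sigma>) = n"
  by (simp add: inv_word_def del: upt_Suc)

lemma nth_inv_word [simp]: "k < n \<Longrightarrow> inv_word n \<sigma> ! k = inv \<sigma> (Suc k)"
  by (simp add: inv_word_def del: upt_Suc)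

context
  fixes n :: nat and J :: "nat set" and \<sigma> :: "nat \<Rightarrow> nat"
  assumes J: "finite J" and perm: "\<sigma> permutes {1..n}" and DES: "DES n \<sigma> \<subseteq> J"
begin

lemma increasing_on_block:
  assumes "block J p = block J q" "1 \<le> p" "p < q" "q \<le> n"
  shows "\<sigma> p < \<sigma> q"
proof -
  have step: "\<sigma> i < \<sigma> (Suc i)" if "p \<le> i" "Suc i \<le> q" for i
  proof -
    have "block J p \<le> block J i" "block J (Suc i) \<le> block J q"
      using that J by (auto intro: block_mono)
    then have "i \<notin> J" using assms(1) block_Suc[OF J, of i] by auto
    then have "i \<notin> DES n \<sigma>" using DES by blast
    then have "\<sigma> i \<le> \<sigma> (Suc i)" using that assms by (auto simp: DES_def)
    moreover have "\<sigma> i \<noteq> \<sigma> (Suc i)" using permutes_inj[OF perm] by (simp add: inj_eq)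
    ultimately show ?thesis by simp
  qed
  have "q' \<le> q \<Longrightarrow> \<sigma> p < \<sigma> q'" if "Suc p \<le> q'" for q'
    using that
  proof (induction q' rule: dec_induct)
    case (step i)
    then have "\<sigma> p < \<sigma> i" "\<sigma> i < \<sigma> (Suc i)" using \<open>\<And>i. p \<le> i \<Longrightarrow> Suc i \<le> q \<Longrightarrow> \<sigma> i < \<sigma> (Suc i)\<close> by auto
    then show ?case by simp
  qed (simp add: step)
  then show ?thesis using assms(3) by simp
qed

lemma inv_in: "k < n \<Longrightarrow> inv \<sigma> (Suc k) \<in> {1..n}"
  using permutes_in_image[OF permutes_inv[OF perm], of "Suc k"] by simp

text \<open>Across blocks the block numbers decide; inside a block \<open>\<sigma>\<close>
  increases, so the values decide.\<close>

lemma inv_less_iff: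
  assumes "k < n" "l < n"
  defines "p \<equiv> inv \<sigma> (Suc l)" and "q \<equiv> inv \<sigma> (Suc k)"
  shows "p < q \<longleftrightarrow> block J p < block J q \<or> block J p = block J q \<and> l < k"
proof -
  have inv: "\<sigma> p = Suc l" "\<sigma> q = Suc k"
    unfolding p_def q_def using permutes_inverses(1)[OF perm] by auto
  have in_range: "p \<in> {1..n}" "q \<in> {1..n}" using inv_in assms by auto
  show ?thesis
  proof (cases p q rule: linorder_cases)
    case less
    then show ?thesis
      using block_mono[OF J, of p q] increasing_on_block[of p q] inv in_range by auto
  next
    case equal
    then show ?thesis using inv by auto
  next
    case greater
    then show ?thesis
      using block_mono[OF J, of q p] increasing_on_block[of q p] inv in_range by auto
  qed
qed

text \<open>The standardization of the block word is \<open>inv \<sigma>\<close>: by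
  \<open>inv_less_iff\<close>, \<open>rank\<close> counts the values whose preimage lies further
  left.\<close>

lemma rank_inv_word:
  assumes "k < n"
  shows "Suc (rank (map (block J) (inv_word n \<sigma>)) k) = inv \<sigma> (Suc k)"
proof -
  let ?p = "\<lambda>l. inv \<sigma> (Suc l)"
  have "rank (map (block J) (inv_word n \<sigma>)) k =
      card {l. l < n \<and> block J (?p l) < block J (?p k)} +
      card {l. l < k \<and> block J (?p l) = block J (?p k)}"
    using assms unfolding rank_def length_filter_conv_card
    by (intro arg_cong2[where f = "(+)"] arg_cong[where f = card]) auto
  also have "\<dots> = card ({l. l < n \<and> block J (?p l) < block J (?p k)} \<union>
      {l. l < k \<and> block J (?p l) = block J (?p k)})"
    by (intro card_Un_disjoint[symmetric]) auto
  also have "{l. l < n \<and> block J (?p l) < block J (?p k)} \<union>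
      {l. l < k \<and> block J (?p l) = block J (?p k)} = {l. l < n \<and> ?p l < ?p k}"
    using inv_less_iff[OF assms] assms by auto
  also have "card \<dots> = card {1..<?p k}"
  proof (intro bij_betw_same_card[of ?p] bij_betwI[of _ _ _ "\<lambda>q. \<sigma> q - 1"])
    show "?p \<in> {l. l < n \<and> ?p l < ?p k} \<rightarrow> {1..<?p k}" using inv_in by auto
    show "(\<lambda>q. \<sigma> q - 1) \<in> {1..<?p k} \<rightarrow> {l. l < n \<and> ?p l < ?p k}"
    proof
      fix q assume q: "q \<in> {1..<?p k}"
      then have "\<sigma> q \<in> {1..n}"
        using permutes_in_image[OF perm, of q] inv_in[OF assms] by auto
      then show "\<sigma> q - 1 \<in> {l. l < n \<and> ?p l < ?p k}"
        using q permutes_inverses(2)[OF perm] by auto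
    qed
    show "\<sigma> (?p l) - 1 = l" for l using permutes_inverses(1)[OF perm] by simp
    fix q assume q: "q \<in> {1..<?p k}"
    then have "\<sigma> q \<in> {1..n}"
      using permutes_in_image[OF perm, of q] inv_in[OF assms] by auto
    then show "?p (\<sigma> q - 1) = q" using permutes_inverses(2)[OF perm] by auto
  qed
  finally show ?thesis using inv_in[OF assms] by simp
qed

text \<open>\<open>Q\<close> relates a position of \<open>\<sigma>\<close> to the value there; index
  \<open>k\<close> of the word stands for the value \<open>Suc k\<close>, and its rank for the
  position.\<close>

lemma card_inv_word:
  assumes "\<And>k. k < n \<Longrightarrow> Q (Suc (rank (map (block J) (inv_word n \<sigma>)) k)) (Suc k) \<longleftrightarrow> R k"
  shows "card {k. k < n \<and> R k} = card {q \<in> {1..n}. Q q (\<sigma> q)}"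
proof (intro bij_betw_same_card[of "\<lambda>k. inv \<sigma> (Suc k)"] bij_betwI[of _ _ _ "\<lambda>q. \<sigma> q - 1"])
  have R: "R k \<longleftrightarrow> Q (inv \<sigma> (Suc k)) (Suc k)" if "k < n" for k
    using assms rank_inv_word that by simp
  show "(\<lambda>k. inv \<sigma> (Suc k)) \<in> {k. k < n \<and> R k} \<rightarrow> {q \<in> {1..n}. Q q (\<sigma> q)}"
    using inv_in R permutes_inverses(1)[OF perm] by auto
  have range: "\<sigma> q \<in> {1..n}" if "q \<in> {1..n}" for q using permutes_in_image[OF perm] that by blast
  then show "(\<lambda>q. \<sigma> q - 1) \<in> {q \<in> {1..n}. Q q (\<sigma> q)} \<rightarrow> {k. k < n \<and> R k}"
    using R permutes_inverses(2)[OF perm] by fastforce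
  show "\<sigma> (inv \<sigma> (Suc k)) - 1 = k" for k using permutes_inverses(1)[OF perm] by simp
  show "inv \<sigma> (Suc (\<sigma> q - 1)) = q" if "q \<in> {q \<in> {1..n}. Q q (\<sigma> q)}" for q
    using range[of q] that permutes_inverses(2)[OF perm] by auto
qed

lemma word_exc_inv_word: "word_exc (map (block J) (inv_word n \<sigma>)) = exc n \<sigma>"
proof -
  let ?w = "map (block J) (inv_word n \<sigma>)"
  have "word_exc ?w = card {k. k < n \<and> rank ?w k < k}"
    unfolding word_exc_def length_filter_conv_card
    by (intro arg_cong[where f = card]) auto
  also have "\<dots> = exc n \<sigma>" unfolding exc_def by (rule card_inv_word[where Q = "\<lambda>q r. r > q"]) simp
  finally show ?thesis .
qed

lemma size_fix_letters_inv_word: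
  "size (fix_letters (map (block J) (inv_word n \<sigma>))) = card (fixed_points n \<sigma>)"
proof -
  let ?w = "map (block J) (inv_word n \<sigma>)"
  have "size (fix_letters ?w) = card {k. k < n \<and> rank ?w k = k}"
    unfolding fix_letters_def size_mset length_map length_filter_conv_card
    by (intro arg_cong[where f = card]) auto
  also have "\<dots> = card (fixed_points n \<sigma>)"
    unfolding fixed_points_def by (rule card_inv_word[where Q = "\<lambda>q r. r = q"]) auto
  finally show ?thesis .
qed

lemma sorted_wrt_inv_word:
  "sorted_wrt (\<lambda>x y. y < x \<longleftrightarrow> block J y < block J x) (inv_word n \<sigma>)"
  unfolding sorted_wrt_iff_nth_less using inv_less_iff by auto

text \<open>The hook side is thereby expressed without \<open>J\<close>, as inclusion-exclusion
  needs one summand for all subsets of \<open>J\<close>.\<close>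

lemma pix_lec_inv_word:
  "pix (map (block J) (inv_word n \<sigma>)) = [] \<longleftrightarrow> pix (inv_word n \<sigma>) = []"
  "lec (map (block J) (inv_word n \<sigma>)) = lec (inv_word n \<sigma>)"
  "pix (butlast (map (block J) (inv_word n \<sigma>))) = [] \<longleftrightarrow> pix (butlast (inv_word n \<sigma>)) = []"
  "lec (butlast (map (block J) (inv_word n \<sigma>))) = lec (butlast (inv_word n \<sigma>))"
proof -
  have "sorted_wrt (\<lambda>x y. y < x \<longleftrightarrow> block J y < block J x) (butlast (inv_word n \<sigma>))"
    using sorted_wrt_inv_word by (simp add: butlast_conv_take sorted_wrt_take)
  then show "pix (map (block J) (inv_word n \<sigma>)) = [] \<longleftrightarrow> pix (inv_word n \<sigma>) = []"
  "lec (map (block J) (inv_word n \<sigma>)) = lec (inv_word n \<sigma>)"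
  "pix (butlast (map (block J) (inv_word n \<sigma>))) = [] \<longleftrightarrow> pix (butlast (inv_word n \<sigma>)) = []"
  "lec (butlast (map (block J) (inv_word n \<sigma>))) = lec (butlast (inv_word n \<sigma>))"
    using pix_lec_map sorted_wrt_inv_word by (auto simp flip: map_butlast)
qed

end

section \<open>Recovering a permutation from its word of blocks\<close>

lemma rank_mono:
  assumes "l < k" "k < length w" "w ! l = w ! k"
  shows "rank w l < rank w k"
proof -
  have "take k w = take l w @ w ! l # drop (Suc l) (take k w)"
    using id_take_nth_drop[of l "take k w"] assms by simp
  then have "filter (\<lambda>z. z = w ! k) (take k w) =
      filter (\<lambda>z. z = w ! k) (take l w) @ w ! k # filter (\<lambda>z. z = w ! k) (drop (Suc l) (take k w))"
    using assms(3) by (metis (mono_tags, lifting) filter.simps(2) filter_append)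
  then show ?thesis using assms(3) by (simp add: rank_def)
qed

lemma rank_mono_letter:
  assumes "l < length w" "w ! l < w ! k"
  shows "rank w l < rank w k"
  using rank_upper[OF assms(2,1)] by (simp add: rank_def)

lemma rank_less_length:
  assumes "k < length w"
  shows "rank w k < length w"
  using rank_upper[of w k "Suc (w ! k)"] assms by (auto intro: less_le_trans length_filter_le)

lemma inj_on_rank: "inj_on (rank w) {..<length w}"
proof (rule linorder_inj_onI)
  fix l k assume "l < k" "l \<in> {..<length w}" "k \<in> {..<length w}"
  then show "rank w l \<noteq> rank w k"
    using rank_mono[of l k w] rank_mono_letter[of l w k] rank_mono_letter[of k w l]
    by (cases "w ! l" "w ! k" rule: linorder_cases) auto
qed auto

text \<open>By monotonicity of \<open>block J\<close> each \<open>S v\<close> is an initial segment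
  of \<open>{1..n}\<close>, and its size is the number of letters below \<open>v\<close>. Comparing
  the rank with the sizes for \<open>w ! k\<close> and its successor pins down the block.\<close>

lemma block_rank:
  assumes "finite J" and w: "mset w = image_mset (block J) (mset_set {1..n})" and k: "k < n"
  shows "block J (Suc (rank w k)) = w ! k"
proof -
  have len: "length w = n" using arg_cong[OF w, of size] by simp
  define S where "S = (\<lambda>v. {q \<in> {1..n}. block J q < v})"
  have "size (filter_mset (\<lambda>z. z < v) (mset w)) = card (S v)" for v
    unfolding w S_def by (simp add: filter_mset_image_mset filter_mset_mset_set)
  then have count: "length (filter (\<lambda>z. z < v) w) = card (S v)" for v
    by (simp flip: mset_filter)
  have S: "block J q < v \<longleftrightarrow> q \<le> card (S v)" if q: "q \<in> {1..n}" for q v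
  proof
    assume "block J q < v"
    then have "{1..q} \<subseteq> S v" using q block_mono[OF assms(1)] by (fastforce simp: S_def)
    then have "card {1..q} \<le> card (S v)" by (intro card_mono) (auto simp: S_def)
    then show "q \<le> card (S v)" by simp
  next
    assume le: "q \<le> card (S v)"
    show "block J q < v"
    proof (rule ccontr)
      assume "\<not> block J q < v"
      then have "p < q" if "p \<in> S v" for p
        using block_mono[OF assms(1), of q p] that by (auto simp: S_def not_less[symmetric])
      then have "S v \<subseteq> {1..<q}" by (auto simp: S_def)
      then have "card (S v) \<le> card {1..<q}" by (intro card_mono) auto
      with le q show False by (cases q) auto
    qed
  qed
  have "Suc (rank w k) \<in> {1..n}" using rank_less_length[of k w] k len by simp
  moreover have "card (S (w ! k)) \<le> rank w k" by (simp add: rank_def flip: count)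
  moreover have "rank w k < card (S (Suc (w ! k)))"
    using rank_upper[of w k "Suc (w ! k)"] k len by (simp flip: count)
  ultimately have "\<not> block J (Suc (rank w k)) < w ! k" "block J (Suc (rank w k)) < Suc (w ! k)"
    using S by auto
  then show ?thesis by simp
qed

lemma bij_betw_inv_word:
  assumes J: "finite J"
  shows "bij_betw (\<lambda>\<sigma>. map (block J) (inv_word n \<sigma>)) {\<sigma> \<in> {\<sigma>. \<sigma> permutes {1..n}}. DES n \<sigma> \<subseteq> J}
    (permutations_of_multiset (image_mset (block J) (mset_set {1..n})))"
  unfolding bij_betw_def
proof
  let ?S = "{\<sigma> \<in> {\<sigma>. \<sigma> permutes {1..n}}. DES n \<sigma> \<subseteq> J}"
  let ?f = "\<lambda>\<sigma>. map (block J) (inv_word n \<sigma>)"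
  show "inj_on ?f ?S"
  proof (rule inj_onI)
    fix \<sigma> \<tau> assume a: "\<sigma> \<in> ?S" "\<tau> \<in> ?S" "?f \<sigma> = ?f \<tau>"
    have "inv \<sigma> q = inv \<tau> q" for q
    proof (cases "q \<in> {1..n}")
      case True
      then obtain k where "q = Suc k" "k < n" by (cases q) auto
      then show ?thesis
        using rank_inv_word[OF J, of \<sigma> n k] rank_inv_word[OF J, of \<tau> n k] a by auto
    next
      case False
      then show ?thesis using a permutes_not_in permutes_inv by (metis (no_types, lifting) mem_Collect_eq)
    qed
    then have "inv (inv \<sigma>) = inv (inv \<tau>)" by presburger
    then show "\<sigma> = \<tau>" using a permutes_inv_inv by (metis (no_types, lifting) mem_Collect_eq)
  qed
  show "?f ` ?S = permutations_of_multiset (image_mset (block J) (mset_set {1..n}))"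
  proof
    show "?f ` ?S \<subseteq> permutations_of_multiset (image_mset (block J) (mset_set {1..n}))"
    proof
      fix w assume "w \<in> ?f ` ?S"
      then obtain \<sigma> where \<sigma>: "\<sigma> permutes {1..n}" "w = ?f \<sigma>" by auto
      have "mset (inv_word n \<sigma>) = image_mset (inv \<sigma>) (mset_set {1..n})"
        by (simp add: inv_word_def atLeastLessThanSuc_atLeastAtMost del: upt_Suc)
      also have "\<dots> = mset_set {1..n}"
        using permutes_inv[OF \<sigma>(1)] by (simp add: image_mset_mset_set permutes_inj_on permutes_image)
      finally show "w \<in> permutations_of_multiset (image_mset (block J) (mset_set {1..n}))"
        by (simp add: \<sigma>(2) permutations_of_multiset_def)
    qed
    show "permutations_of_multiset (image_mset (block J) (mset_set {1..n})) \<subseteq> ?f ` ?S"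
    proof
      fix w assume "w \<in> permutations_of_multiset (image_mset (block J) (mset_set {1..n}))"
      then have w: "mset w = image_mset (block J) (mset_set {1..n})"
        by (simp add: permutations_of_multiset_def)
      have len: "length w = n" using arg_cong[OF w, of size] by simp
      \<comment> \<open>The standardization of \<open>w\<close>, counted from 1; its inverse is the
        preimage sought.\<close>
      define \<pi> where "\<pi> = (\<lambda>p. if p \<in> {1..n} then Suc (rank w (p - 1)) else p)"
      have "inj_on \<pi> {1..n}"
      proof (rule inj_onI)
        fix p q assume pq: "p \<in> {1..n}" "q \<in> {1..n}" "\<pi> p = \<pi> q"
        then have "rank w (p - 1) = rank w (q - 1)" by (simp add: \<pi>_def)
        then have "p - 1 = q - 1" using inj_on_rank[of w] pq len by (auto dest: inj_onD)
        then show "p = q" using pq by auto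
      qed
      moreover have "\<pi> p \<in> {1..n}" if "p \<in> {1..n}" for p
        using rank_less_length[of "p - 1" w] len that by (cases p) (auto simp: \<pi>_def)
      then have "\<pi> ` {1..n} \<subseteq> {1..n}" by blast
      ultimately have "bij_betw \<pi> {1..n} {1..n}"
        using endo_inj_surj[of "{1..n}" \<pi>] by (simp add: bij_betw_def)
      then have \<pi>: "\<pi> permutes {1..n}" by (rule bij_imp_permutes) (auto simp: \<pi>_def)
      have inv: "inv (inv \<pi>) = \<pi>" using \<pi> by (rule permutes_inv_inv)
      have "?f (inv \<pi>) = w"
      proof (rule nth_equalityI)
        fix k assume "k < length (?f (inv \<pi>))"
        moreover from this have "\<pi> (Suc k) = Suc (rank w k)" by (simp add: \<pi>_def)
        ultimately show "?f (inv \<pi>) ! k = w ! k" using block_rank[OF J w] by (simp add: inv)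
      qed (simp add: len)
      moreover have "DES n (inv \<pi>) \<subseteq> J"
      proof
        fix i assume i: "i \<in> DES n (inv \<pi>)"
        define k l where "k = inv \<pi> i - 1" and "l = inv \<pi> (Suc i) - 1"
        have range: "inv \<pi> i \<in> {1..n}" "inv \<pi> (Suc i) \<in> {1..n}"
          unfolding permutes_in_image[OF permutes_inv[OF \<pi>]] using i by (auto simp: DES_def)
        have "\<pi> (inv \<pi> i) = i" "\<pi> (inv \<pi> (Suc i)) = Suc i" using permutes_inverses(1)[OF \<pi>] by auto
        then have rank: "Suc (rank w k) = i" "Suc (rank w l) = Suc i"
          using range by (simp_all add: \<pi>_def k_def l_def)
        have kl: "l < k" "k < n" using i range by (auto simp: DES_def k_def l_def)
        show "i \<in> J"
        proof (rule ccontr)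
          \<comment> \<open>Then \<open>i\<close> and \<open>Suc i\<close> share a block, so the
            letters at \<open>l < k\<close> agree and \<open>rank w l < rank w k\<close>, against
            the computed ranks.\<close>
          assume "i \<notin> J"
          then have "w ! l = w ! k"
            using block_rank[OF J w, of k] block_rank[OF J w, of l] rank kl by (simp add: block_Suc_eq)
          then show False using rank_mono[of l k w] kl len rank by simp
        qed
      qed
      ultimately show "w \<in> ?f ` ?S" using permutes_inv[OF \<pi>] by (intro image_eqI[of _ _ "inv \<pi>"]) auto
    qed
  qed
qed

section \<open>Inclusion-exclusion over descent sets\<close>

lemma sum_eq_by_subsets:
  fixes f g :: "'a \<Rightarrow> 'b::ab_group_add" and d :: "'a \<Rightarrow> 'c set"
  assumes "finite S" "finite J"
    and "\<And>I. I \<subseteq> J \<Longrightarrow> (\<Sum>x\<in>{x \<in> S. d x \<subseteq> I}. f x) = (\<Sum>x\<in>{x \<in> S. d x \<subseteq> I}. g x)"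
  shows "(\<Sum>x\<in>{x \<in> S. d x = J}. f x) = (\<Sum>x\<in>{x \<in> S. d x = J}. g x)"
  using assms(2,3)
proof (induction J rule: finite_psubset_induct)
  case (psubset J)
  \<comment> \<open>Subtracting the sums for proper subsets, equal by induction, replaces signed
    inclusion-exclusion.\<close>
  have split: "(\<Sum>x\<in>{x \<in> S. d x \<subseteq> J}. h x) = (\<Sum>x\<in>{x \<in> S. d x = J}. h x) +
      (\<Sum>I\<in>Pow J - {J}. \<Sum>x\<in>{x \<in> S. d x = I}. h x)" for h :: "'a \<Rightarrow> 'b"
  proof -
    have "(\<Sum>x\<in>{x \<in> S. d x \<subseteq> J}. h x) = (\<Sum>I\<in>Pow J. \<Sum>x\<in>{x \<in> {x \<in> S. d x \<subseteq> J}. d x = I}. h x)"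
      using assms(1) psubset.hyps by (intro sum.group[symmetric]) auto
    also have "\<dots> = (\<Sum>I\<in>Pow J. \<Sum>x\<in>{x \<in> S. d x = I}. h x)"
      by (intro sum.cong) auto
    also have "\<dots> = (\<Sum>x\<in>{x \<in> S. d x = J}. h x) + (\<Sum>I\<in>Pow J - {J}. \<Sum>x\<in>{x \<in> S. d x = I}. h x)"
      using psubset.hyps by (intro sum.remove) auto
    finally show ?thesis .
  qed
  have "(\<Sum>I\<in>Pow J - {J}. \<Sum>x\<in>{x \<in> S. d x = I}. f x) =
      (\<Sum>I\<in>Pow J - {J}. \<Sum>x\<in>{x \<in> S. d x = I}. g x)"
  proof (rule sum.cong[OF refl])
    fix I assume "I \<in> Pow J - {J}"
    then show "(\<Sum>x\<in>{x \<in> S. d x = I}. f x) = (\<Sum>x\<in>{x \<in> S. d x = I}. g x)"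
      using psubset.prems by (intro psubset.IH) auto
  qed
  then show ?case using psubset.prems[of J] split[of f] split[of g] by simp
qed

lemma sum_inv_word:
  assumes "finite J"
  shows "(\<Sum>\<sigma>\<in>{\<sigma> \<in> {\<sigma>. \<sigma> permutes {1..n}}. DES n \<sigma> \<subseteq> J}. h (map (block J) (inv_word n \<sigma>))) =
    (\<Sum>w\<in>permutations_of_multiset (image_mset (block J) (mset_set {1..n})). h w)"
  using assms by (intro sum.reindex_bij_betw bij_betw_inv_word)

text \<open>The conditions become \<open>if\<close> with default 0, so that both summands live on
  the same set, as \<open>sum_eq_by_subsets\<close> requires.\<close>

lemma sum_D0:
  fixes s :: "'a::comm_ring_1"
  assumes "finite J"
  shows "(\<Sum>\<sigma>\<in>D0 n J. s ^ exc n \<sigma>) =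
    (\<Sum>\<sigma>\<in>{\<sigma> \<in> {\<sigma>. \<sigma> permutes {1..n}}. DES n \<sigma> = J}.
       if pix (inv_word n \<sigma>) = [] then s ^ lec (inv_word n \<sigma>) else 0)"
proof -
  let ?P = "{\<sigma>. \<sigma> permutes {1..n}}"
  have "(\<Sum>\<sigma>\<in>{\<sigma> \<in> ?P. DES n \<sigma> = J}. if card (fixed_points n \<sigma>) = 0 then s ^ exc n \<sigma> else 0) =
    (\<Sum>\<sigma>\<in>{\<sigma> \<in> ?P. DES n \<sigma> = J}.
       if pix (inv_word n \<sigma>) = [] then s ^ lec (inv_word n \<sigma>) else 0)"
  proof (rule sum_eq_by_subsets[OF _ assms])
    show "finite ?P" by (simp add: finite_permutations)
    fix I assume "I \<subseteq> J"
    then have I: "finite I" using assms finite_subset by blast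
    define e where "e = image_mset (block I) (mset_set {1..n})"
    let ?S = "{\<sigma> \<in> ?P. DES n \<sigma> \<subseteq> I}"
    have "(\<Sum>\<sigma>\<in>?S. if card (fixed_points n \<sigma>) = 0 then s ^ exc n \<sigma> else 0) =
        (\<Sum>\<sigma>\<in>?S. (\<lambda>w. if fix_letters w = {#} then s ^ word_exc w else 0)
          (map (block I) (inv_word n \<sigma>)))"
      using word_exc_inv_word[OF I] size_fix_letters_inv_word[OF I]
      by (intro sum.cong refl) (auto simp flip: size_eq_0_iff_empty)
    also have "\<dots> = fix_letters.enum s e {#}"
      unfolding sum_inv_word[OF I, of "\<lambda>w. if fix_letters w = {#} then s ^ word_exc w else 0"] fix_letters.enum_def e_def[symmetric]
      by (simp add: sum.inter_filter)
    also have "\<dots> = pix.enum s e {#}"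
      by (intro enum_unique fix_letters.letter_stat_axioms pix.letter_stat_axioms)
    also have "\<dots> = (\<Sum>\<sigma>\<in>?S. (\<lambda>w. if pix w = [] then s ^ lec w else 0)
          (map (block I) (inv_word n \<sigma>)))"
      unfolding sum_inv_word[OF I, of "\<lambda>w. if pix w = [] then s ^ lec w else 0"] pix.enum_def e_def[symmetric]
      by (simp add: sum.inter_filter)
    also have "\<dots> = (\<Sum>\<sigma>\<in>?S. if pix (inv_word n \<sigma>) = [] then s ^ lec (inv_word n \<sigma>) else 0)"
      using pix_lec_inv_word[OF I] by (intro sum.cong refl) auto
    finally show "(\<Sum>\<sigma>\<in>?S. if card (fixed_points n \<sigma>) = 0 then s ^ exc n \<sigma> else 0) = \<dots>" .
  qed
  moreover have "finite {\<sigma> \<in> ?P. DES n \<sigma> = J}" by (simp add: finite_permutations)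
  moreover have "D0 n J = {\<sigma> \<in> {\<sigma> \<in> ?P. DES n \<sigma> = J}. card (fixed_points n \<sigma>) = 0}"
    by (auto simp: D0_def fixed_points_def)
  ultimately show ?thesis by (simp only: sum.inter_filter)
qed

text \<open>Both enumerators pass through the sum over the deleted letter \<open>b\<close>: a fixed
  letter on one side, the last letter on the other.\<close>

lemma sum_D1:
  fixes s :: "'a::comm_ring_1"
  assumes "finite J" "n \<ge> 1"
  shows "(\<Sum>\<sigma>\<in>D1 n J. s ^ exc n \<sigma>) =
    (\<Sum>\<sigma>\<in>{\<sigma> \<in> {\<sigma>. \<sigma> permutes {1..n}}. DES n \<sigma> = J}.
       if pix (butlast (inv_word n \<sigma>)) = [] then s ^ lec (butlast (inv_word n \<sigma>)) else 0)"
proof -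
  let ?P = "{\<sigma>. \<sigma> permutes {1..n}}"
  have "(\<Sum>\<sigma>\<in>{\<sigma> \<in> ?P. DES n \<sigma> = J}. if card (fixed_points n \<sigma>) = 1 then s ^ exc n \<sigma> else 0) =
    (\<Sum>\<sigma>\<in>{\<sigma> \<in> ?P. DES n \<sigma> = J}.
       if pix (butlast (inv_word n \<sigma>)) = [] then s ^ lec (butlast (inv_word n \<sigma>)) else 0)"
  proof (rule sum_eq_by_subsets[OF _ assms(1)])
    show "finite ?P" by (simp add: finite_permutations)
    fix I assume "I \<subseteq> J"
    then have I: "finite I" using assms finite_subset by blast
    define e where "e = image_mset (block I) (mset_set {1..n})"
    have e: "e \<noteq> {#}" using assms(2) by (auto simp: e_def mset_set_empty_iff)
    let ?S = "{\<sigma> \<in> ?P. DES n \<sigma> \<subseteq> I}"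
    have "(\<Sum>\<sigma>\<in>?S. if card (fixed_points n \<sigma>) = 1 then s ^ exc n \<sigma> else 0) =
        (\<Sum>\<sigma>\<in>?S. (\<lambda>w. if size (fix_letters w) = 1 then s ^ word_exc w else 0)
          (map (block I) (inv_word n \<sigma>)))"
      using word_exc_inv_word[OF I] size_fix_letters_inv_word[OF I]
      by (intro sum.cong refl) auto
    also have "\<dots> = (\<Sum>b\<in>set_mset e. fix_letters.enum s (e - {#b#}) {#})"
      unfolding sum_inv_word[OF I, of "\<lambda>w. if size (fix_letters w) = 1 then s ^ word_exc w else 0"] fix_letters.sum_one_letter[symmetric] e_def[symmetric]
      by (simp add: sum.inter_filter)
    also have "\<dots> = (\<Sum>b\<in>set_mset e. pix.enum s (e - {#b#}) {#})"
      by (intro sum.cong refl enum_unique fix_letters.letter_stat_axioms pix.letter_stat_axioms)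
    also have "\<dots> = (\<Sum>\<sigma>\<in>?S. (\<lambda>w. if pix (butlast w) = [] then s ^ lec (butlast w) else 0)
          (map (block I) (inv_word n \<sigma>)))"
      unfolding sum_inv_word[OF I, of "\<lambda>w. if pix (butlast w) = [] then s ^ lec (butlast w) else 0"] sum_butlast[OF e, symmetric] e_def[symmetric]
      by (simp add: sum.inter_filter)
    also have "\<dots> = (\<Sum>\<sigma>\<in>?S. if pix (butlast (inv_word n \<sigma>)) = []
        then s ^ lec (butlast (inv_word n \<sigma>)) else 0)"
      using pix_lec_inv_word[OF I] by (intro sum.cong refl) auto
    finally show "(\<Sum>\<sigma>\<in>?S. if card (fixed_points n \<sigma>) = 1 then s ^ exc n \<sigma> else 0) = \<dots>" .
  qed
  moreover have "finite {\<sigma> \<in> ?P. DES n \<sigma> = J}" by (simp add: finite_permutations)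
  moreover have "D1 n J = {\<sigma> \<in> {\<sigma> \<in> ?P. DES n \<sigma> = J}. card (fixed_points n \<sigma>) = 1}"
    by (auto simp: D1_def)
  ultimately show ?thesis by (simp only: sum.inter_filter)
qed

section \<open>Excluding the reversal, and the final comparison\<close>

lemma inv_word_not_decreasing:
  assumes "\<sigma> permutes {1..n}" "DES n \<sigma> \<noteq> {1..n - 1}"
  shows "\<not> sorted_wrt (\<lambda>x y. y < x) (inv_word n \<sigma>)"
proof
  assume dec: "sorted_wrt (\<lambda>x y. y < x) (inv_word n \<sigma>)"
  have "\<sigma> i > \<sigma> (i + 1)" if i: "i \<in> {1..n - 1}" for i
  proof (rule ccontr)
    assume "\<not> \<sigma> i > \<sigma> (i + 1)"
    moreover have "\<sigma> i \<noteq> \<sigma> (i + 1)" using permutes_inj[OF assms(1)] by (simp add: inj_eq)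
    ultimately have less: "\<sigma> i < \<sigma> (i + 1)" by simp
    have range: "\<sigma> i \<in> {1..n}" "\<sigma> (i + 1) \<in> {1..n}"
      unfolding permutes_in_image[OF assms(1)] using i by auto
    then have idx: "\<sigma> i - 1 < \<sigma> (i + 1) - 1" "\<sigma> (i + 1) - 1 < n" "\<sigma> i - 1 < n"
      using less by auto
    have "inv \<sigma> (Suc (\<sigma> (i + 1) - 1)) < inv \<sigma> (Suc (\<sigma> i - 1))"
      using sorted_wrt_nth_less[OF dec idx(1)] idx(2,3) by simp
    moreover have "Suc (\<sigma> (i + 1) - 1) = \<sigma> (i + 1)" "Suc (\<sigma> i - 1) = \<sigma> i" using range by auto
    ultimately show False by (simp only: permutes_inverses(2)[OF assms(1)])
  qed
  then show False using assms(2) by (auto simp: DES_def)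
qed

theorem theorem2:
  fixes n :: nat and J :: "nat set"
  assumes "n \<ge> 1" and "J \<subset> {1..n - 1}"
  shows "\<exists>Q :: int poly. (\<forall>i. coeff Q i \<ge> 0) \<and>
    (\<Sum>\<sigma>\<in>D0 n J. monom 1 (exc n \<sigma>)) - (\<Sum>\<sigma>\<in>D1 n J. monom 1 (exc n \<sigma>)) = (monom 1 1 - 1) * Q"
proof -
  let ?S = "{\<sigma> \<in> {\<sigma>. \<sigma> permutes {1..n}}. DES n \<sigma> = J}"
  let ?a = "\<lambda>\<sigma>. lec (inv_word n \<sigma>)" and ?b = "\<lambda>\<sigma>. lec (butlast (inv_word n \<sigma>))"
  define s :: "int poly" where "s = monom 1 1"
  have s: "monom 1 k = s ^ k" for k by (simp add: s_def monom_power)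
  \<comment> \<open>The quotient of \<open>s ^ ?a \<sigma> - s ^ ?b \<sigma>\<close> by
    \<open>s - 1\<close>, a geometric sum because \<open>?b \<sigma> \<le> ?a \<sigma>\<close> on
    \<open>?S\<close>.\<close>
  define q where "q = (\<lambda>\<sigma>. if pix (inv_word n \<sigma>) = [] then \<Sum>k\<in>{?b \<sigma>..<?a \<sigma>}. s ^ k else 0)"
  have J: "finite J" using assms(2) finite_subset by blast
  have "(\<Sum>\<sigma>\<in>D0 n J. s ^ exc n \<sigma>) - (\<Sum>\<sigma>\<in>D1 n J. s ^ exc n \<sigma>) = (\<Sum>\<sigma>\<in>?S. (s - 1) * q \<sigma>)"
    unfolding sum_D0[OF J] sum_D1[OF J assms(1)] sum_subtractf[symmetric]
  proof (rule sum.cong[OF refl])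
    fix \<sigma> assume "\<sigma> \<in> ?S"
    then have "\<not> sorted_wrt (\<lambda>x y. y < x) (inv_word n \<sigma>)"
      using assms(2) by (intro inv_word_not_decreasing) auto
    note lb = lec_butlast[OF this]
    have "s ^ ?a \<sigma> - s ^ ?b \<sigma> = (\<Sum>k\<in>{?b \<sigma>..<?a \<sigma>}. s ^ Suc k - s ^ k)"
      using lb(2) by (rule sum_Suc_diff'[symmetric])
    also have "\<dots> = (s - 1) * (\<Sum>k\<in>{?b \<sigma>..<?a \<sigma>}. s ^ k)"
      by (simp add: sum_distrib_left algebra_simps)
    finally show "(if pix (inv_word n \<sigma>) = [] then s ^ ?a \<sigma> else 0) -
        (if pix (butlast (inv_word n \<sigma>)) = [] then s ^ ?b \<sigma> else 0) = (s - 1) * q \<sigma>"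
      using lb(1) by (simp add: q_def)
  qed
  then have "(\<Sum>\<sigma>\<in>D0 n J. monom 1 (exc n \<sigma>)) - (\<Sum>\<sigma>\<in>D1 n J. monom 1 (exc n \<sigma>)) =
      (monom 1 1 - 1) * (\<Sum>\<sigma>\<in>?S. q \<sigma>)"
    unfolding s by (simp add: sum_distrib_left)
  moreover have "coeff (\<Sum>\<sigma>\<in>?S. q \<sigma>) i \<ge> 0" for i
    by (auto simp: coeff_sum q_def simp flip: s intro!: sum_nonneg)
  ultimately show ?thesis by blast
qed

end
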